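(* Let $(G_\bullet,\iota,\zeta,\kappa,\pi)$ be a restricted operadic cloning system. For $f\in G_n$, $g\in G_m$ and $1\le i\le n$ define $$f\circ_i g=\kappa^n_i(m)(f)\cdot\nu^m_i(n)(g)\in G_{n+m-1},$$ and let $\mathrm{id}=e_1$ be the identity of the group $G_1$. Then $(G_\bullet,\pi,\{\circ_i\}_i,\mathrm{id})$ is an action operad. If $(G_\bullet,\iota,\zeta,\kappa,\pi)$ is only assumed to be an operadic cloning system (not necessarily restricted), then $(G_\bullet,\pi,\{\circ_i\}_i,\mathrm{id})$, defined in the same way, is a general action operad.
   Context: **Symmetric groups.** $\Sigma_n$ is the group of permutations of $\{1,\dots,n\}$, with product $(\sigma\tau)(i)=\sigma(\tau(i))$. Define maps $\Sigma_n\to\Sigma_{n+1}$: $\lambda_n(\sigma)$ agrees with $\sigma$ on $\{1,\dots,n\}$ and fixes $n+1$; $\rho_n(\sigma)(1)=1$ and $\rho_n(\sigma)(i)=\sigma(i-1)+1$ for $2\le i\le n+1$; and, for $1\le j\le n$, $c^n_j(\sigma)(i)$ equals $\sigma(i)$ if $i\le j$ and $\sigma(i)\le\sigma(j)$; $\sigma(i)+1$ if $i<j$ and $\sigma(i)>\sigma(j)$; $\sigma(i-1)$ if $i>j+1$ and $\sigma(i-1)<\sigma(j)$; $\sigma(i-1)+1$ if $i\ge j+1$ and $\sigma(i-1)\ge\sigma(j)$. (This duplicates the $j$-th strand.) The partial compositions $\circ_i:\Sigma_n\times\Sigma_m\to\Sigma_{n+m-1}$ are: $(\sigma\circ_i\tau)(i-1+t)=\sigma(i)-1+\tau(t)$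 for $1\le t\le m$; and for $k\ne i$, with $k'=k$ if $k<i$ and $k'=k+m-1$ if $k>i$, $(\sigma\circ_i\tau)(k')=\sigma(k)$ if $\sigma(k)<\sigma(i)$ and $\sigma(k)+m-1$ if $\sigma(k)>\sigma(i)$. These make $\{\Sigma_n\}_{n\ge1}$ a non-symmetric operad of sets. **Action operads.** An *action operad* is $(G_\bullet,\pi,\{\circ_i\}_i,\mathrm{id})$ with (1) $G_\bullet=\{G_n\}_{n\ge1}$ a family of groups, $\mathrm{id}\in G_1$, and maps of sets $\circ_i:G_n\times G_m\to G_{n+m-1}$ ($1\le i\le n$) forming a non-symmetric operad of sets (no arity $0$): for $f\in G_n$, $g\in G_m$, $h\in G_l$, $(f\circ_i g)\circ_j h$ equals $(f\circ_j h)\circ_{i+l-1}g$ if $j<i$, $(f\circ_{j-m+1}h)\circ_i g$ if $j\ge i+m$, and $f\circ_i(g\circ_{j-i+1}h)$ if $i\le j\le i+m-1$; moreover $f\circ_i\mathrm{id}=f$ and $\mathrm{id}\circ_1 g=g$; (2) $\pi=\{\pi_n:G_n\to\Sigma_n\}$ group homomorphisms with $\pi_{n+m-1}(g\circ_i h)=\pi_n(g)\circ_i\pi_m(h)$ and $\pi_1(\mathrm{id})=\mathrm{id}$; (3) $(f f')\circ_i(g g')=(f\circ_{\pi_n(f')(i)}g)\cdot(f'\circ_i g')$ for all $f,f'\in G_n$, $g,g'\in G_m$, $1\le i\le n$. A *general action operad* is such a tuple satisfying (1), (3) and, in place of (2): (2') each $\pi_n:G_n\to\Sigma_n$ is a group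 homomorphism and, for $g\in G_n$, $h\in G_m$, the permutations $\pi_n(g)\circ_i\pi_m(h)$ and $\pi_{n+m-1}(g\circ_i h)$ coincide on $\{1,\dots,n+m-1\}\setminus\{i,\dots,i+m-1\}$. **Cloning systems.** A *cloning system* $(G_\bullet,\iota,\kappa,\pi)$ consists of groups $G_n$ ($n\ge1$), homomorphisms $\iota_n:G_n\to G_{n+1}$ and $\pi_n:G_n\to\Sigma_n$, and maps of sets $\kappa^n_j:G_n\to G_{n+1}$ ($1\le j\le n$) such that for all admissible indices and elements: (i) $\pi_{n+1}\iota_n=\lambda_n\pi_n$; (ii) $\pi_{n+1}(\kappa^n_j(g))(i)=c^n_j(\pi_n(g))(i)$ for all $i\ne j,j+1$; (iii) $\iota_{n+1}\kappa^n_j=\kappa^{n+1}_j\iota_n$; (iv) $\kappa^{n+1}_{j+1}\kappa^n_l=\kappa^{n+1}_l\kappa^n_j$ for $l<j\le n$; (v) $\kappa^n_j(gh)=\kappa^n_{\pi_n(h)(j)}(g)\,\kappa^n_j(h)$. A *bilateral cloning system* $(G_\bullet,\iota,\zeta,\kappa,\pi)$ is a cloning system together with homomorphisms $\zeta_n:G_n\to G_{n+1}$ such that (iv+) $\kappa^{n+1}_{j+1}\kappa^n_j=\kappa^{n+1}_j\kappa^n_j$; (vii) $\iota_{n+1}\iota_n=\kappa^{n+1}_{n+1}\iota_n$; (i') $\pi_{n+1}\zeta_n=\rho_n\pi_n$; (iii') $\zeta_{n+1}\kappa^n_j=\kappa^{n+1}_{j+1}\zeta_n$; (vi) $\zeta_{n+1}\iota_n=\iota_{n+1}\zeta_n$;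 (vii') $\zeta_{n+1}\zeta_n=\kappa^{n+1}_1\zeta_n$. It is *restricted* if moreover (ii+) $\pi_{n+1}\kappa^n_j=c^n_j\pi_n$ for all $n,j$. Put $\iota_n(r)=\iota_{n+r-1}\cdots\iota_n:G_n\to G_{n+r}$, $\zeta_n(l)=\zeta_{n+l-1}\cdots\zeta_n:G_n\to G_{n+l}$, $\kappa^n_j(m)=\kappa^{n+m-2}_j\cdots\kappa^n_j:G_n\to G_{n+m-1}$ and $\nu^n_j(m)=\zeta_{n+m-j}(j-1)\circ\iota_n(m-j):G_n\to G_{n+m-1}$ for $1\le j\le m$, with $\iota_n(0)=\zeta_n(0)=\kappa^n_j(1)=\mathrm{id}$. A bilateral cloning system is *operadic* if for all $m,n\ge1$, $g\in G_n$, $h\in G_m$: (viii) $\kappa^n_i(m)(g)\cdot\nu^m_i(n)(h)=\nu^m_{\pi_n(g)(i)}(n)(h)\cdot\kappa^n_i(m)(g)$ for $1\le i\le n$; (ix) $\iota_n(m)(g)\cdot\zeta_m(n)(h)=\zeta_m(n)(h)\cdot\iota_n(m)(g)$. *)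

theory Defs
  imports "HOL-Algebra.Sym_Groups"
begin

text \<open>
  The group of permutations of \<open>{1..n}\<close> is \<^const>\<open>sym_group\<close> \<open>n\<close>. Its elements are functions on
  \<^typ>\<open>nat\<close> that are the identity outside \<open>{1..n}\<close>, so every map below is extended by the
  identity outside its range of definition.
\<close>

definition perm_lambda :: "nat \<Rightarrow> (nat \<Rightarrow> nat) \<Rightarrow> nat \<Rightarrow> nat" where
  "perm_lambda n \<sigma> i = (if i \<in> {1..n} then \<sigma> i else i)"

definition perm_rho :: "nat \<Rightarrow> (nat \<Rightarrow> nat) \<Rightarrow> nat \<Rightarrow> nat" where
  "perm_rho n \<sigma> i = (if i \<in> {2..n + 1} then \<sigma> (i - 1) + 1 else i)"

definition perm_clone :: "nat \<Rightarrow> nat \<Rightarrow> (nat \<Rightarrow> nat) \<Rightarrow> nat \<Rightarrow> nat" where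
  "perm_clone n j \<sigma> i =
     (if i \<notin> {1..n + 1} then i
      else if i \<le> j then (if \<sigma> i \<le> \<sigma> j then \<sigma> i else \<sigma> i + 1)
      else (if \<sigma> (i - 1) < \<sigma> j then \<sigma> (i - 1) else \<sigma> (i - 1) + 1))"

text \<open>
  \<open>perm_circ n m i \<sigma> \<tau>\<close> is \<open>\<sigma> \<circ>\<^sub>i \<tau>\<close> for \<open>\<sigma>\<close> of arity \<open>n\<close> and \<open>\<tau>\<close> of arity \<open>m\<close>. At a position
  \<open>p\<close> outside the block \<open>{i..<i + m}\<close> (the \<open>k'\<close> of the usual description), the bound \<open>k\<close> is the
  corresponding position in \<open>{1..n}\<close>.
\<close>

definition perm_circ ::
    "nat \<Rightarrow> nat \<Rightarrow> nat \<Rightarrow> (nat \<Rightarrow> nat) \<Rightarrow> (nat \<Rightarrow> nat) \<Rightarrow> nat \<Rightarrow> nat" where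
  "perm_circ n m i \<sigma> \<tau> p =
     (if p \<notin> {1..n + m - 1} then p
      else if p \<in> {i..<i + m} then \<sigma> i - 1 + \<tau> (p + 1 - i)
      else (let k = (if p < i then p else p - (m - 1))
            in if \<sigma> k < \<sigma> i then \<sigma> k else \<sigma> k + (m - 1)))"

text \<open>
  All components of a family live in one type, so partial compositions carry both arities:
  \<open>circ n m i f g\<close> is \<open>f \<circ>\<^sub>i g\<close> for \<open>f\<close> of arity \<open>n\<close> and \<open>g\<close> of arity \<open>m\<close>. Nothing is assumed
  about the component of index \<open>0\<close>.
\<close>

locale nonsymmetric_operad =
  fixes X :: "nat \<Rightarrow> 'a set"
    and circ :: "nat \<Rightarrow> nat \<Rightarrow> nat \<Rightarrow> 'a \<Rightarrow> 'a \<Rightarrow> 'a"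
    and unit :: 'a
  assumes unit_closed: "unit \<in> X 1"
    and circ_closed:
      "\<lbrakk>1 \<le> n; 1 \<le> m; 1 \<le> i; i \<le> n; f \<in> X n; g \<in> X m\<rbrakk>
       \<Longrightarrow> circ n m i f g \<in> X (n + m - 1)"
    and circ_left:
      "\<lbrakk>1 \<le> n; 1 \<le> m; 1 \<le> l; 1 \<le> i; i \<le> n; 1 \<le> j; j < i; f \<in> X n; g \<in> X m; h \<in> X l\<rbrakk>
       \<Longrightarrow> circ (n + m - 1) l j (circ n m i f g) h
           = circ (n + l - 1) m (i + l - 1) (circ n l j f h) g"
    and circ_right:
      "\<lbrakk>1 \<le> n; 1 \<le> m; 1 \<le> l; 1 \<le> i; i \<le> n; i + m \<le> j; j \<le> n + m - 1;
        f \<in> X n; g \<in> X m; h \<in> X l\<rbrakk>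
       \<Longrightarrow> circ (n + m - 1) l j (circ n m i f g) h
           = circ (n + l - 1) m i (circ n l (j + 1 - m) f h) g"
    and circ_nested:
      "\<lbrakk>1 \<le> n; 1 \<le> m; 1 \<le> l; 1 \<le> i; i \<le> n; i \<le> j; j \<le> i + m - 1;
        f \<in> X n; g \<in> X m; h \<in> X l\<rbrakk>
       \<Longrightarrow> circ (n + m - 1) l j (circ n m i f g) h
           = circ n (m + l - 1) i f (circ m l (j - i + 1) g h)"
    and circ_unit: "\<lbrakk>1 \<le> n; 1 \<le> i; i \<le> n; f \<in> X n\<rbrakk> \<Longrightarrow> circ n 1 i f unit = f"
    and unit_circ: "\<lbrakk>1 \<le> m; g \<in> X m\<rbrakk> \<Longrightarrow> circ 1 m 1 unit g = g"

locale action_operad_base =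
  nonsymmetric_operad "\<lambda>n. carrier (G n)" circ unit
  for G :: "nat \<Rightarrow> ('a, 'b) monoid_scheme"
    and \<pi> :: "nat \<Rightarrow> 'a \<Rightarrow> nat \<Rightarrow> nat"
    and circ :: "nat \<Rightarrow> nat \<Rightarrow> nat \<Rightarrow> 'a \<Rightarrow> 'a \<Rightarrow> 'a"
    and unit :: 'a +
  assumes group_G: "1 \<le> n \<Longrightarrow> group (G n)"
    and \<pi>_hom: "1 \<le> n \<Longrightarrow> \<pi> n \<in> hom (G n) (sym_group n)"
    and circ_mult:
      "\<lbrakk>1 \<le> n; 1 \<le> m; 1 \<le> i; i \<le> n;
        f \<in> carrier (G n); f' \<in> carrier (G n); g \<in> carrier (G m); g' \<in> carrier (G m)\<rbrakk>
       \<Longrightarrow> circ n m i (f \<otimes>\<^bsub>G n\<^esub> f') (g \<otimes>\<^bsub>G m\<^esub> g')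
           = circ n m (\<pi> n f' i) f g \<otimes>\<^bsub>G (n + m - 1)\<^esub> circ n m i f' g'"

locale action_operad = action_operad_base G \<pi> circ unit
  for G :: "nat \<Rightarrow> ('a, 'b) monoid_scheme"
    and \<pi> :: "nat \<Rightarrow> 'a \<Rightarrow> nat \<Rightarrow> nat"
    and circ :: "nat \<Rightarrow> nat \<Rightarrow> nat \<Rightarrow> 'a \<Rightarrow> 'a \<Rightarrow> 'a"
    and unit :: 'a +
  assumes \<pi>_circ:
      "\<lbrakk>1 \<le> n; 1 \<le> m; 1 \<le> i; i \<le> n; g \<in> carrier (G n); h \<in> carrier (G m)\<rbrakk>
       \<Longrightarrow> \<pi> (n + m - 1) (circ n m i g h) = perm_circ n m i (\<pi> n g) (\<pi> m h)"
    and \<pi>_unit: "\<pi> 1 unit = id"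

locale general_action_operad = action_operad_base G \<pi> circ unit
  for G :: "nat \<Rightarrow> ('a, 'b) monoid_scheme"
    and \<pi> :: "nat \<Rightarrow> 'a \<Rightarrow> nat \<Rightarrow> nat"
    and circ :: "nat \<Rightarrow> nat \<Rightarrow> nat \<Rightarrow> 'a \<Rightarrow> 'a \<Rightarrow> 'a"
    and unit :: 'a +
  assumes \<pi>_circ_off_block:
      "\<lbrakk>1 \<le> n; 1 \<le> m; 1 \<le> i; i \<le> n; g \<in> carrier (G n); h \<in> carrier (G m);
        p \<in> {1..n + m - 1} - {i..i + m - 1}\<rbrakk>
       \<Longrightarrow> perm_circ n m i (\<pi> n g) (\<pi> m h) p = \<pi> (n + m - 1) (circ n m i g h) p"

locale cloning_system =
  fixes G :: "nat \<Rightarrow> ('a, 'b) monoid_scheme"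
    and \<iota> :: "nat \<Rightarrow> 'a \<Rightarrow> 'a"
    and \<kappa> :: "nat \<Rightarrow> nat \<Rightarrow> 'a \<Rightarrow> 'a"
    and \<pi> :: "nat \<Rightarrow> 'a \<Rightarrow> nat \<Rightarrow> nat"
  assumes group_G: "1 \<le> n \<Longrightarrow> group (G n)"
    and \<iota>_hom: "1 \<le> n \<Longrightarrow> \<iota> n \<in> hom (G n) (G (n + 1))"
    and \<pi>_hom: "1 \<le> n \<Longrightarrow> \<pi> n \<in> hom (G n) (sym_group n)"
    and \<kappa>_closed:
      "\<lbrakk>1 \<le> n; 1 \<le> j; j \<le> n; g \<in> carrier (G n)\<rbrakk> \<Longrightarrow> \<kappa> n j g \<in> carrier (G (n + 1))"
    and \<pi>_\<iota>: "\<lbrakk>1 \<le> n; g \<in> carrier (G n)\<rbrakk> \<Longrightarrow> \<pi> (n + 1) (\<iota> n g) = perm_lambda n (\<pi> n g)"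
    and \<pi>_\<kappa>_off:
      "\<lbrakk>1 \<le> n; 1 \<le> j; j \<le> n; g \<in> carrier (G n); i \<in> {1..n + 1} - {j, j + 1}\<rbrakk>
       \<Longrightarrow> \<pi> (n + 1) (\<kappa> n j g) i = perm_clone n j (\<pi> n g) i"
    and \<iota>_\<kappa>:
      "\<lbrakk>1 \<le> n; 1 \<le> j; j \<le> n; g \<in> carrier (G n)\<rbrakk>
       \<Longrightarrow> \<iota> (n + 1) (\<kappa> n j g) = \<kappa> (n + 1) j (\<iota> n g)"
    and \<kappa>_\<kappa>:
      "\<lbrakk>1 \<le> n; 1 \<le> l; l < j; j \<le> n; g \<in> carrier (G n)\<rbrakk>
       \<Longrightarrow> \<kappa> (n + 1) (j + 1) (\<kappa> n l g) = \<kappa> (n + 1) l (\<kappa> n j g)"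
    and \<kappa>_mult:
      "\<lbrakk>1 \<le> n; 1 \<le> j; j \<le> n; g \<in> carrier (G n); h \<in> carrier (G n)\<rbrakk>
       \<Longrightarrow> \<kappa> n j (g \<otimes>\<^bsub>G n\<^esub> h) = \<kappa> n (\<pi> n h j) g \<otimes>\<^bsub>G (n + 1)\<^esub> \<kappa> n j h"

locale bilateral_cloning_system = cloning_system G \<iota> \<kappa> \<pi>
  for G :: "nat \<Rightarrow> ('a, 'b) monoid_scheme"
    and \<iota> :: "nat \<Rightarrow> 'a \<Rightarrow> 'a"
    and \<zeta> :: "nat \<Rightarrow> 'a \<Rightarrow> 'a"
    and \<kappa> :: "nat \<Rightarrow> nat \<Rightarrow> 'a \<Rightarrow> 'a"
    and \<pi> :: "nat \<Rightarrow> 'a \<Rightarrow> nat \<Rightarrow> nat" +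
  assumes \<zeta>_hom: "1 \<le> n \<Longrightarrow> \<zeta> n \<in> hom (G n) (G (n + 1))"
    and \<kappa>_\<kappa>_same:
      "\<lbrakk>1 \<le> n; 1 \<le> j; j \<le> n; g \<in> carrier (G n)\<rbrakk>
       \<Longrightarrow> \<kappa> (n + 1) (j + 1) (\<kappa> n j g) = \<kappa> (n + 1) j (\<kappa> n j g)"
    and \<iota>_\<iota>:
      "\<lbrakk>1 \<le> n; g \<in> carrier (G n)\<rbrakk> \<Longrightarrow> \<iota> (n + 1) (\<iota> n g) = \<kappa> (n + 1) (n + 1) (\<iota> n g)"
    and \<pi>_\<zeta>: "\<lbrakk>1 \<le> n; g \<in> carrier (G n)\<rbrakk> \<Longrightarrow> \<pi> (n + 1) (\<zeta> n g) = perm_rho n (\<pi> n g)"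
    and \<zeta>_\<kappa>:
      "\<lbrakk>1 \<le> n; 1 \<le> j; j \<le> n; g \<in> carrier (G n)\<rbrakk>
       \<Longrightarrow> \<zeta> (n + 1) (\<kappa> n j g) = \<kappa> (n + 1) (j + 1) (\<zeta> n g)"
    and \<zeta>_\<iota>: "\<lbrakk>1 \<le> n; g \<in> carrier (G n)\<rbrakk> \<Longrightarrow> \<zeta> (n + 1) (\<iota> n g) = \<iota> (n + 1) (\<zeta> n g)"
    and \<zeta>_\<zeta>: "\<lbrakk>1 \<le> n; g \<in> carrier (G n)\<rbrakk> \<Longrightarrow> \<zeta> (n + 1) (\<zeta> n g) = \<kappa> (n + 1) 1 (\<zeta> n g)"

locale restricted_bilateral_cloning_system = bilateral_cloning_system G \<iota> \<zeta> \<kappa> \<pi>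
  for G :: "nat \<Rightarrow> ('a, 'b) monoid_scheme"
    and \<iota> :: "nat \<Rightarrow> 'a \<Rightarrow> 'a"
    and \<zeta> :: "nat \<Rightarrow> 'a \<Rightarrow> 'a"
    and \<kappa> :: "nat \<Rightarrow> nat \<Rightarrow> 'a \<Rightarrow> 'a"
    and \<pi> :: "nat \<Rightarrow> 'a \<Rightarrow> nat \<Rightarrow> nat" +
  assumes \<pi>_\<kappa>:
      "\<lbrakk>1 \<le> n; 1 \<le> j; j \<le> n; g \<in> carrier (G n)\<rbrakk>
       \<Longrightarrow> \<pi> (n + 1) (\<kappa> n j g) = perm_clone n j (\<pi> n g)"

text \<open>\<open>iterate_map \<phi> n r = \<phi> (n + r - 1) \<circ> \<dots> \<circ> \<phi> n\<close>, giving \<open>\<iota>\<^sub>n(r)\<close> and \<open>\<zeta>\<^sub>n(r)\<close>.\<close>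

primrec iterate_map :: "(nat \<Rightarrow> 'a \<Rightarrow> 'a) \<Rightarrow> nat \<Rightarrow> nat \<Rightarrow> 'a \<Rightarrow> 'a" where
  "iterate_map \<phi> n 0 = id"
| "iterate_map \<phi> n (Suc r) = \<phi> (n + r) \<circ> iterate_map \<phi> n r"

text \<open>
  \<open>iterate_clone \<kappa> n j m\<close> is \<open>\<kappa>\<^sup>n\<^sub>j(m)\<close> and \<open>insert_map \<iota> \<zeta> n j m\<close> is \<open>\<nu>\<^sup>n\<^sub>j(m)\<close>; both take arity
  \<open>n\<close> to arity \<open>n + m - 1\<close>.
\<close>

definition iterate_clone ::
    "(nat \<Rightarrow> nat \<Rightarrow> 'a \<Rightarrow> 'a) \<Rightarrow> nat \<Rightarrow> nat \<Rightarrow> nat \<Rightarrow> 'a \<Rightarrow> 'a" where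
  "iterate_clone \<kappa> n j m = iterate_map (\<lambda>k. \<kappa> k j) n (m - 1)"

definition insert_map ::
    "(nat \<Rightarrow> 'a \<Rightarrow> 'a) \<Rightarrow> (nat \<Rightarrow> 'a \<Rightarrow> 'a) \<Rightarrow> nat \<Rightarrow> nat \<Rightarrow> nat \<Rightarrow> 'a \<Rightarrow> 'a" where
  "insert_map \<iota> \<zeta> n j m = iterate_map \<zeta> (n + m - j) (j - 1) \<circ> iterate_map \<iota> n (m - j)"

locale operadic_cloning_system = bilateral_cloning_system G \<iota> \<zeta> \<kappa> \<pi>
  for G :: "nat \<Rightarrow> ('a, 'b) monoid_scheme"
    and \<iota> :: "nat \<Rightarrow> 'a \<Rightarrow> 'a"
    and \<zeta> :: "nat \<Rightarrow> 'a \<Rightarrow> 'a"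
    and \<kappa> :: "nat \<Rightarrow> nat \<Rightarrow> 'a \<Rightarrow> 'a"
    and \<pi> :: "nat \<Rightarrow> 'a \<Rightarrow> nat \<Rightarrow> nat" +
  assumes clone_insert_commute:
      "\<lbrakk>1 \<le> n; 1 \<le> m; 1 \<le> i; i \<le> n; g \<in> carrier (G n); h \<in> carrier (G m)\<rbrakk>
       \<Longrightarrow> iterate_clone \<kappa> n i m g \<otimes>\<^bsub>G (n + m - 1)\<^esub> insert_map \<iota> \<zeta> m i n h
           = insert_map \<iota> \<zeta> m (\<pi> n g i) n h \<otimes>\<^bsub>G (n + m - 1)\<^esub> iterate_clone \<kappa> n i m g"
    and \<iota>_\<zeta>_commute:
      "\<lbrakk>1 \<le> n; 1 \<le> m; g \<in> carrier (G n); h \<in> carrier (G m)\<rbrakk>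
       \<Longrightarrow> iterate_map \<iota> n m g \<otimes>\<^bsub>G (n + m)\<^esub> iterate_map \<zeta> m n h
           = iterate_map \<zeta> m n h \<otimes>\<^bsub>G (n + m)\<^esub> iterate_map \<iota> n m g"

definition cloning_circ ::
    "(nat \<Rightarrow> ('a, 'b) monoid_scheme) \<Rightarrow> (nat \<Rightarrow> 'a \<Rightarrow> 'a) \<Rightarrow> (nat \<Rightarrow> 'a \<Rightarrow> 'a)
     \<Rightarrow> (nat \<Rightarrow> nat \<Rightarrow> 'a \<Rightarrow> 'a) \<Rightarrow> nat \<Rightarrow> nat \<Rightarrow> nat \<Rightarrow> 'a \<Rightarrow> 'a \<Rightarrow> 'a" where
  "cloning_circ G \<iota> \<zeta> \<kappa> n m i f g =
     iterate_clone \<kappa> n i m f \<otimes>\<^bsub>G (n + m - 1)\<^esub> insert_map \<iota> \<zeta> m i n g"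

end

theory Submission
  imports Defs
begin

text \<open>
  Both sides of every operad axiom expand, by multiplicativity of \<open>\<kappa>\<close>, into a product of a cloned
  \<open>f\<close>, a cloned and inserted \<open>g\<close> and an inserted \<open>h\<close>. Cloning \<open>\<nu>(g)\<close> at a strand of \<open>g\<close> clones
  \<open>g\<close>, whereas cloning it at an added strand only adds further strands. In the nested case the
  factors then agree in order; for disjoint positions the last two are exchanged by the
  commutation of \<open>\<iota>\<close>- and \<open>\<zeta>\<close>-images.

  Without restrictedness, \<open>\<pi>(\<kappa>\<^sub>j(g))\<close> is unknown at \<open>j\<close> and \<open>j + 1\<close>. Since it is a permutation that
  is known elsewhere, it still maps the block of clones of \<open>j\<close> onto the block of clones of
  \<open>\<pi>(g)(j)\<close>, and repeated cloning does not depend on which clone in a block is cloned next.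
\<close>

section \<open>Iterated maps between consecutive arities, and blocks in a permutation\<close>

lemma iterate_map_add:
  "iterate_map \<phi> n (r + s) x = iterate_map \<phi> (n + r) s (iterate_map \<phi> n r x)"
  by (induction s) (simp_all add: ac_simps)

lemma iterate_map_closed:
  assumes "\<And>k x. \<lbrakk>n \<le> k; x \<in> A k\<rbrakk> \<Longrightarrow> \<phi> k x \<in> A (Suc k)" and "x \<in> A n"
  shows "iterate_map \<phi> n r x \<in> A (n + r)"
  by (induction r) (simp_all add: assms)

lemma iterate_map_hom:
  assumes "\<And>k. n \<le> k \<Longrightarrow> \<phi> k \<in> hom (G k) (G (Suc k))"
  shows "iterate_map \<phi> n r \<in> hom (G n) (G (n + r))"
proof (induction r)
  case 0
  show ?case by (simp add: hom_def id_def)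
next
  case (Suc r)
  then show ?case
    using assms[of "n + r"] hom_compose[of "iterate_map \<phi> n r" "G n" "G (n + r)" "\<phi> (n + r)"] by (simp add: o_def)
qed

text \<open>Double induction: \<open>swap1\<close> carries one \<open>\<theta>\<close> past a whole
  row of maps \<open>\<phi> s\<close>, and the induction on \<open>s\<close> repeats this. The label
  \<open>s\<close> counts the maps \<open>\<theta>\<close> already passed: passing a
  \<open>\<zeta>\<close>, or a clone further left, raises a cloning index by one. For maps without
  such a shift, \<open>\<phi>\<close> is taken constant in \<open>s\<close>.\<close>

lemma iterate_map_swap:
  fixes A :: "nat \<Rightarrow> 'a set"
  assumes \<phi>: "\<And>s k x. \<lbrakk>n + s \<le> k; x \<in> A k\<rbrakk> \<Longrightarrow> \<phi> s k x \<in> A (Suc k)"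
    and \<theta>: "\<And>k x. \<lbrakk>n \<le> k; x \<in> A k\<rbrakk> \<Longrightarrow> \<theta> k x \<in> A (Suc k)"
    and swap: "\<And>s k x. \<lbrakk>n + s \<le> k; x \<in> A k\<rbrakk> \<Longrightarrow> \<theta> (Suc k) (\<phi> s k x) = \<phi> (Suc s) (Suc k) (\<theta> k x)"
    and x: "x \<in> A n"
  shows "iterate_map \<theta> (n + r) s (iterate_map (\<phi> 0) n r x)
         = iterate_map (\<phi> s) (n + s) r (iterate_map \<theta> n s x)"
proof (induction s)
  case 0
  show ?case by simp
next
  case (Suc s)
  have swap1: "\<theta> (n + s + t) (iterate_map (\<phi> s) (n + s) t y)
               = iterate_map (\<phi> (Suc s)) (Suc (n + s)) t (\<theta> (n + s) y)"
    if y: "y \<in> A (n + s)" for t y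
  proof (induction t)
    case (Suc t)
    have "iterate_map (\<phi> s) (n + s) t y \<in> A (n + s + t)"
      by (rule iterate_map_closed[where A = A]) (auto intro: \<phi> y)
    then show ?case
      using swap[of s "n + s + t"] Suc by simp
  qed simp
  have "iterate_map \<theta> n s x \<in> A (n + s)"
    by (rule iterate_map_closed[where A = A]) (auto intro: \<theta> x)
  then show ?case
    using Suc swap1[of "iterate_map \<theta> n s x" r] by (simp add: ac_simps)
qed

text \<open>Pigeonhole: positions outside the block already take every value of
  \<open>{1..n + r}\<close> outside \<open>{\<sigma> i..\<sigma> i + r}\<close>, so injectivity of
  \<open>\<tau>\<close> leaves only that interval for the block.\<close>

lemma permutes_block:
  fixes \<sigma> \<tau> :: "nat \<Rightarrow> nat"
  assumes \<sigma>: "\<sigma> permutes {1..n}" and \<tau>: "\<tau> permutes {1..n + r}" and i: "1 \<le> i" "i \<le> n"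
    and lo: "\<And>p. \<lbrakk>1 \<le> p; p < i\<rbrakk> \<Longrightarrow> \<tau> p = (if \<sigma> p < \<sigma> i then \<sigma> p else \<sigma> p + r)"
    and hi: "\<And>k. \<lbrakk>i < k; k \<le> n\<rbrakk> \<Longrightarrow> \<tau> (k + r) = (if \<sigma> k < \<sigma> i then \<sigma> k else \<sigma> k + r)"
    and p: "i \<le> p" "p \<le> i + r"
  shows "\<sigma> i \<le> \<tau> p \<and> \<tau> p \<le> \<sigma> i + r"
proof (rule ccontr)
  assume neg: "\<not> ?thesis"
  \<comment> \<open>\<open>v\<close> undoes the spreading of values that opens a gap of size
    \<open>r\<close> after \<open>\<sigma> i\<close>. Its preimage \<open>k\<close> under
    \<open>\<sigma>\<close> differs from \<open>i\<close>, and the copy of \<open>k\<close> under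
    \<open>\<tau>\<close> collides with \<open>p\<close>.\<close>
  define v where "v = (if \<tau> p < \<sigma> i then \<tau> p else \<tau> p - r)"
  have \<sigma>i: "\<sigma> i \<in> {1..n}"
    using permutes_in_image[OF \<sigma>, of i] i by simp
  have \<tau>p: "\<tau> p \<in> {1..n + r}"
    using permutes_in_image[OF \<tau>, of p] i p by simp
  have v: "v \<in> {1..n}" "v \<noteq> \<sigma> i" "\<tau> p = (if v < \<sigma> i then v else v + r)"
    using neg \<sigma>i \<tau>p by (auto simp: v_def)
  obtain k where k: "\<sigma> k = v"
    using permutes_surj[OF \<sigma>] by (metis surjD)
  have "k \<in> {1..n}" "k \<noteq> i"
    using permutes_in_image[OF \<sigma>, of k] k v by metis+
  then consider "1 \<le> k" "k < i" | "i < k" "k \<le> n"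
    by fastforce
  then show False
  proof cases
    case 1
    then have "\<tau> k = \<tau> p" using lo[of k] k v by simp
    then show False using injD[OF permutes_inj[OF \<tau>], of k p] 1 p by simp
  next
    case 2
    then have "\<tau> (k + r) = \<tau> p" using hi[of k] k v by simp
    then show False using injD[OF permutes_inj[OF \<tau>], of "k + r" p] 2 p by simp
  qed
qed

section \<open>Exchange and absorption rules for added and cloned strands\<close>

context bilateral_cloning_system
begin

abbreviation \<iota>s where "\<iota>s \<equiv> iterate_map \<iota>"
abbreviation \<zeta>s where "\<zeta>s \<equiv> iterate_map \<zeta>"
text \<open>The last argument counts added strands, so \<open>\<kappa>s n j r\<close> is
  \<open>iterate_clone \<kappa> n j (r + 1)\<close>, and target arities are plain sums.\<close>

abbreviation \<kappa>s where "\<kappa>s n j \<equiv> iterate_map (\<lambda>k. \<kappa> k j) n"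

lemma \<iota>s_hom: "1 \<le> n \<Longrightarrow> \<iota>s n r \<in> hom (G n) (G (n + r))"
  using \<iota>_hom by (intro iterate_map_hom) auto

lemma \<zeta>s_hom: "1 \<le> n \<Longrightarrow> \<zeta>s n r \<in> hom (G n) (G (n + r))"
  using \<zeta>_hom by (intro iterate_map_hom) auto

lemma \<iota>s_closed [simp]: "\<lbrakk>1 \<le> n; x \<in> carrier (G n)\<rbrakk> \<Longrightarrow> \<iota>s n r x \<in> carrier (G (n + r))"
  by (rule hom_in_carrier[OF \<iota>s_hom])

lemma \<zeta>s_closed [simp]: "\<lbrakk>1 \<le> n; x \<in> carrier (G n)\<rbrakk> \<Longrightarrow> \<zeta>s n r x \<in> carrier (G (n + r))"
  by (rule hom_in_carrier[OF \<zeta>s_hom])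

lemma \<kappa>s_closed:
  "\<lbrakk>1 \<le> j; j \<le> n; x \<in> carrier (G n)\<rbrakk> \<Longrightarrow> \<kappa>s n j r x \<in> carrier (G (n + r))"
  using \<kappa>_closed by (intro iterate_map_closed[where A = "\<lambda>k. carrier (G k)"]) auto

lemma \<iota>_closed: "\<lbrakk>1 \<le> n; x \<in> carrier (G n)\<rbrakk> \<Longrightarrow> \<iota> n x \<in> carrier (G (Suc n))"
  using \<iota>s_closed[of n x 1] by simp

lemma \<zeta>_closed: "\<lbrakk>1 \<le> n; x \<in> carrier (G n)\<rbrakk> \<Longrightarrow> \<zeta> n x \<in> carrier (G (Suc n))"
  using \<zeta>s_closed[of n x 1] by simp

lemma \<zeta>s_\<kappa>s:
  "\<lbrakk>1 \<le> j; j \<le> n; x \<in> carrier (G n)\<rbrakk>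
   \<Longrightarrow> \<zeta>s (n + r) s (\<kappa>s n j r x) = \<kappa>s (n + s) (j + s) r (\<zeta>s n s x)"
  using iterate_map_swap[of n "\<lambda>k. carrier (G k)" "\<lambda>s k. \<kappa> k (j + s)" \<zeta> x r s]
    \<kappa>_closed \<zeta>_closed \<zeta>_\<kappa> by simp

lemma \<iota>s_\<kappa>s:
  "\<lbrakk>1 \<le> j; j \<le> n; x \<in> carrier (G n)\<rbrakk>
   \<Longrightarrow> \<iota>s (n + r) s (\<kappa>s n j r x) = \<kappa>s (n + s) j r (\<iota>s n s x)"
  using iterate_map_swap[of n "\<lambda>k. carrier (G k)" "\<lambda>s k. \<kappa> k j" \<iota> x r s]
    \<kappa>_closed \<iota>_closed \<iota>_\<kappa> by simp

lemma \<zeta>s_\<iota>s: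
  "\<lbrakk>1 \<le> n; x \<in> carrier (G n)\<rbrakk>
   \<Longrightarrow> \<zeta>s (n + r) s (\<iota>s n r x) = \<iota>s (n + s) r (\<zeta>s n s x)"
  using iterate_map_swap[of n "\<lambda>k. carrier (G k)" "\<lambda>s k. \<iota> k" \<zeta> x r s]
    \<iota>_closed \<zeta>_closed \<zeta>_\<iota> by simp

lemma \<kappa>s_\<kappa>s:
  "\<lbrakk>1 \<le> j; j < i; i \<le> n; x \<in> carrier (G n)\<rbrakk>
   \<Longrightarrow> \<kappa>s (n + r) j s (\<kappa>s n i r x) = \<kappa>s (n + s) (i + s) r (\<kappa>s n j s x)"
  using iterate_map_swap[of n "\<lambda>k. carrier (G k)" "\<lambda>s k. \<kappa> k (i + s)" "\<lambda>k. \<kappa> k j" x r s]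
    \<kappa>_closed \<kappa>_\<kappa> by simp

text \<open>Cloning at \<open>j + u + 1\<close> right after cloning at \<open>j\<close> equals
  cloning first at \<open>j + u\<close> and then at \<open>j\<close>: this is
  \<open>\<kappa>_\<kappa>\<close> for \<open>u > 0\<close> and
  \<open>\<kappa>_\<kappa>_same\<close> for \<open>u = 0\<close>. The induction hypothesis then
  handles the position \<open>j + u\<close>.\<close>

lemma \<kappa>_block:
  assumes "1 \<le> j" "j \<le> n" "x \<in> carrier (G n)"
  shows "t \<le> r \<Longrightarrow> \<kappa> (n + r) (j + t) (\<kappa>s n j r x) = \<kappa>s n j (Suc r) x"
proof (induction r arbitrary: t)
  case (Suc r)
  let ?y = "\<kappa>s n j r x"
  have y: "?y \<in> carrier (G (n + r))" using assms by (intro \<kappa>s_closed)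
  show ?case
  proof (cases t)
    case (Suc u)
    have "\<kappa> (Suc (n + r)) (Suc (j + u)) (\<kappa> (n + r) j ?y)
          = \<kappa> (Suc (n + r)) j (\<kappa> (n + r) (j + u) ?y)"
      using \<kappa>_\<kappa>[of "n + r" j "j + u" ?y] \<kappa>_\<kappa>_same[of "n + r" j ?y] assms y Suc Suc.prems
      by (cases "u = 0") simp_all
    then show ?thesis using Suc Suc.IH[of u] Suc.prems by simp
  qed simp
qed simp

lemma \<kappa>s_block:
  assumes "1 \<le> j" "j \<le> n" "x \<in> carrier (G n)" "t \<le> r"
  shows "\<kappa>s (n + r) (j + t) s (\<kappa>s n j r x) = \<kappa>s n j (r + s) x"
proof (induction s)
  case (Suc s)
  then show ?case
    using \<kappa>_block[of j n x t "r + s"] assms by (simp add: ac_simps)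
qed simp

text \<open>The leftmost strand is the one added last, and cloning it is one more
  \<open>\<zeta>\<close> by \<open>\<zeta>_\<zeta>\<close>. A clone of any other added strand is
  pulled inside the last \<open>\<zeta>\<close> by \<open>\<zeta>_\<kappa>\<close>, with its index
  lowered by one.\<close>

lemma \<kappa>_\<zeta>s:
  assumes "1 \<le> n" "x \<in> carrier (G n)"
  shows "c < a \<Longrightarrow> \<kappa> (n + a) (Suc c) (\<zeta>s n a x) = \<zeta>s n (Suc a) x"
proof (induction a arbitrary: c)
  case (Suc a)
  have y: "\<zeta>s n a x \<in> carrier (G (n + a))" using assms by simp
  show ?case
  proof (cases c)
    case 0
    then show ?thesis using \<zeta>_\<zeta>[of "n + a" "\<zeta>s n a x"] y assms by simp
  next
    case (Suc d)
    then show ?thesis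
      using \<zeta>_\<kappa>[of "n + a" "Suc d" "\<zeta>s n a x"] Suc.IH[of d] Suc.prems y assms by simp
  qed
qed simp

lemma \<kappa>s_\<zeta>s:
  assumes "1 \<le> n" "x \<in> carrier (G n)" "c < a"
  shows "\<kappa>s (n + a) (Suc c) r (\<zeta>s n a x) = \<zeta>s n (a + r) x"
proof (induction r)
  case (Suc r)
  then show ?case using \<kappa>_\<zeta>s[of n x c "a + r"] assms by (simp add: ac_simps)
qed simp

text \<open>Mirror image of the rule for \<open>\<zeta>\<close>: the strand added last is now the
  rightmost one, and passing \<open>\<iota>\<close> leaves the cloning index unchanged.\<close>

lemma \<kappa>_\<iota>s:
  assumes "1 \<le> n" "x \<in> carrier (G n)"
  shows "c < b \<Longrightarrow> \<kappa> (n + b) (Suc (n + c)) (\<iota>s n b x) = \<iota>s n (Suc b) x"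
proof (induction b)
  case (Suc b)
  have y: "\<iota>s n b x \<in> carrier (G (n + b))" using assms by simp
  show ?case
  proof (cases "c = b")
    case True
    then show ?thesis using \<iota>_\<iota>[of "n + b" "\<iota>s n b x"] y assms by simp
  next
    case False
    then show ?thesis
      using \<iota>_\<kappa>[of "n + b" "Suc (n + c)" "\<iota>s n b x"] Suc y assms by simp
  qed
qed simp

lemma \<kappa>s_\<iota>s:
  assumes "1 \<le> n" "x \<in> carrier (G n)" "c < b"
  shows "\<kappa>s (n + b) (Suc (n + c)) r (\<iota>s n b x) = \<iota>s n (b + r) x"
proof (induction r)
  case (Suc r)
  then show ?case using \<kappa>_\<iota>s[of n x c "b + r"] assms by (simp add: ac_simps)
qed simp

section \<open>Permutations and products under repeated cloning\<close>

lemma \<pi>_permutes: "\<lbrakk>1 \<le> n; x \<in> carrier (G n)\<rbrakk> \<Longrightarrow> \<pi> n x permutes {1..n}"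
  using \<pi>_hom[of n] by (auto dest!: hom_in_carrier simp: sym_group_def)

lemma \<pi>_mult:
  "\<lbrakk>1 \<le> n; x \<in> carrier (G n); y \<in> carrier (G n)\<rbrakk> \<Longrightarrow> \<pi> n (x \<otimes>\<^bsub>G n\<^esub> y) = \<pi> n x \<circ> \<pi> n y"
  using hom_mult[OF \<pi>_hom[of n]] by (simp add: sym_group_def)

lemma \<pi>_one: "1 \<le> n \<Longrightarrow> \<pi> n \<one>\<^bsub>G n\<^esub> = id"
  using hom_one[OF \<pi>_hom group_G sym_group_is_group] by (simp add: sym_group_def)

lemma \<pi>_in_range:
  "\<lbrakk>1 \<le> i; i \<le> n; x \<in> carrier (G n)\<rbrakk> \<Longrightarrow> 1 \<le> \<pi> n x i \<and> \<pi> n x i \<le> n"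
  using permutes_in_image[OF \<pi>_permutes[of n x], of i] by simp

lemma \<pi>_\<iota>s:
  assumes "1 \<le> n" "x \<in> carrier (G n)"
  shows "\<pi> (n + r) (\<iota>s n r x) = \<pi> n x"
proof (induction r)
  case (Suc r)
  have "perm_lambda (n + r) (\<pi> n x) = \<pi> n x"
    using permutes_not_in[OF \<pi>_permutes[OF assms]] by (auto simp: perm_lambda_def fun_eq_iff)
  then show ?case using Suc \<pi>_\<iota>[of "n + r" "\<iota>s n r x"] assms by simp
qed simp

lemma \<pi>_\<zeta>s:
  assumes "1 \<le> n" "x \<in> carrier (G n)"
  shows "\<pi> (n + r) (\<zeta>s n r x) p = (if p \<le> r then p else r + \<pi> n x (p - r))"
proof (induction r arbitrary: p)
  case 0
  show ?case using permutes_not_in[OF \<pi>_permutes[OF assms], of 0] by simp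
next
  case (Suc r)
  \<comment> \<open>The formula has no bound on \<open>p\<close>. Beyond \<open>n + Suc r\<close>,
    where \<open>perm_rho\<close> is the identity, it relies on \<open>\<pi> n x\<close> fixing all
    numbers above \<open>n\<close>.\<close>
  have "\<pi> n x (p - Suc r) = p - Suc r" if "p > n + Suc r"
    using that by (intro permutes_not_in[OF \<pi>_permutes[OF assms]]) auto
  then show ?case using Suc \<pi>_\<zeta>[of "n + r" "\<zeta>s n r x"] assms
    by (auto simp: perm_rho_def)
qed

text \<open>The next clone compares each value with \<open>?\<tau> i\<close>, which the axioms do
  not determine. Both claims at stage \<open>r\<close> together give, by
  \<open>permutes_block\<close>, that \<open>?\<tau> i\<close> lies between
  \<open>\<sigma> i\<close> and \<open>\<sigma> i + r\<close>, and this decides every comparison.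
  Hence the simultaneous induction.\<close>

lemma \<pi>_\<kappa>s_off_block:
  assumes x: "x \<in> carrier (G n)" and i: "1 \<le> i" "i \<le> n"
  defines "\<sigma> \<equiv> \<pi> n x"
  shows "\<And>p. \<lbrakk>1 \<le> p; p < i\<rbrakk>
           \<Longrightarrow> \<pi> (n + r) (\<kappa>s n i r x) p = (if \<sigma> p < \<sigma> i then \<sigma> p else \<sigma> p + r)"
    and "\<And>k. \<lbrakk>i < k; k \<le> n\<rbrakk>
           \<Longrightarrow> \<pi> (n + r) (\<kappa>s n i r x) (k + r) = (if \<sigma> k < \<sigma> i then \<sigma> k else \<sigma> k + r)"
proof (induction r)
  case 0
  {
    case 1
    then show ?case by (simp add: \<sigma>_def)
  next
    case 2
    then show ?case by (simp add: \<sigma>_def)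
  }
next
  case (Suc r)
  let ?y = "\<kappa>s n i r x"
  let ?\<tau> = "\<pi> (n + r) ?y"
  have y: "?y \<in> carrier (G (n + r))" using x i by (intro \<kappa>s_closed)
  have \<sigma>: "\<sigma> permutes {1..n}" using \<pi>_permutes x i by (simp add: \<sigma>_def)
  have "?\<tau> permutes {1..n + r}" using \<pi>_permutes[of "n + r" ?y] y i by simp
  then have b: "\<sigma> i \<le> ?\<tau> i \<and> ?\<tau> i \<le> \<sigma> i + r"
    using permutes_block[OF \<sigma> _ i Suc.IH, of i] by simp
  have \<sigma>_neq: "\<sigma> k \<noteq> \<sigma> i" if "k \<noteq> i" for k
    using injD[OF permutes_inj[OF \<sigma>], of k i] that by blast
  have step: "\<pi> (Suc (n + r)) (\<kappa> (n + r) i ?y) p = perm_clone (n + r) i ?\<tau> p"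
    if "1 \<le> p" "p \<le> Suc (n + r)" "p \<noteq> i" "p \<noteq> Suc i" for p
    using \<pi>_\<kappa>_off[of "n + r" i ?y p] y i that by simp
  {
    case (1 p)
    then show ?case
      using step[of p] Suc.IH(1)[of p] \<sigma>_neq[of p] b i by (auto simp: perm_clone_def)
  next
    case (2 k)
    then show ?case
      using step[of "Suc (k + r)"] Suc.IH(2)[of k] \<sigma>_neq[of k] b i by (auto simp: perm_clone_def)
  }
qed

lemma \<pi>_\<kappa>s_in_block:
  assumes x: "x \<in> carrier (G n)" and i: "1 \<le> i" "i \<le> n"
  shows "\<pi> n x i \<le> \<pi> (n + r) (\<kappa>s n i r x) i \<and> \<pi> (n + r) (\<kappa>s n i r x) i \<le> \<pi> n x i + r"
  using permutes_block[OF \<pi>_permutes \<pi>_permutes i \<pi>_\<kappa>s_off_block[OF x i, where r = r], of i]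
    x i \<kappa>s_closed[OF i x] by simp

text \<open>At each stage \<open>\<kappa>_mult\<close> clones the left factor at \<open>?k\<close>,
  a position known only to lie in the block of clones of \<open>?j\<close>. By
  \<open>\<kappa>_block\<close> the result is the same as cloning at \<open>?j\<close>.\<close>

lemma \<kappa>s_mult:
  assumes x: "x \<in> carrier (G n)" and y: "y \<in> carrier (G n)" and i: "1 \<le> i" "i \<le> n"
  shows "\<kappa>s n i r (x \<otimes>\<^bsub>G n\<^esub> y) = \<kappa>s n (\<pi> n y i) r x \<otimes>\<^bsub>G (n + r)\<^esub> \<kappa>s n i r y"
proof (induction r)
  case (Suc r)
  let ?j = "\<pi> n y i" and ?k = "\<pi> (n + r) (\<kappa>s n i r y) i"
  have j: "1 \<le> ?j" "?j \<le> n" using \<pi>_in_range[OF i y] by simp_all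
  have k: "?j \<le> ?k" "?k \<le> ?j + r" using \<pi>_\<kappa>s_in_block[OF y i] by simp_all
  have "\<kappa> (n + r) ?k (\<kappa>s n ?j r x) = \<kappa>s n ?j (Suc r) x"
    using \<kappa>_block[OF j x, of "?k - ?j" r] k by simp
  then show ?case
    using Suc \<kappa>_mult[of "n + r" i "\<kappa>s n ?j r x" "\<kappa>s n i r y"] \<kappa>s_closed j i x y by simp
qed simp

text \<open>As the unit has trivial permutation, \<open>\<kappa>s_mult\<close> makes its image
  idempotent, and a group has only one idempotent.\<close>

lemma \<kappa>s_one:
  assumes i: "1 \<le> i" "i \<le> n"
  shows "\<kappa>s n i r \<one>\<^bsub>G n\<^esub> = \<one>\<^bsub>G (n + r)\<^esub>"
proof -
  interpret n: group "G n" using group_G i by simp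
  interpret nr: group "G (n + r)" using group_G i by simp
  have "\<kappa>s n i r \<one>\<^bsub>G n\<^esub> = \<kappa>s n i r \<one>\<^bsub>G n\<^esub> \<otimes>\<^bsub>G (n + r)\<^esub> \<kappa>s n i r \<one>\<^bsub>G n\<^esub>"
    using \<kappa>s_mult[of "\<one>\<^bsub>G n\<^esub>" n "\<one>\<^bsub>G n\<^esub>" i r] \<pi>_one[of n] i by simp
  then show ?thesis using \<kappa>s_closed[OF i n.one_closed] by (metis nr.l_cancel_one)
qed

section \<open>Insertion of strands on both sides, and the permutation of
  \<open>cloning_circ\<close>\<close>

text \<open>\<open>\<nu> m a b\<close> is \<open>\<nu>\<^sup>m\<^sub>j(n)\<close> for \<open>j = a + 1\<close> and \<open>n = a + b + 1\<close>: it adds \<open>a\<close> strands on the left and \<open>b\<close> on the right.\<close>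

definition \<nu> :: "nat \<Rightarrow> nat \<Rightarrow> nat \<Rightarrow> 'a \<Rightarrow> 'a" where
  "\<nu> m a b x = \<zeta>s (m + b) a (\<iota>s m b x)"

lemma \<nu>_hom: "1 \<le> m \<Longrightarrow> \<nu> m a b \<in> hom (G m) (G (m + a + b))"
  using hom_compose[OF \<iota>s_hom[of m b] \<zeta>s_hom[of "m + b" a]]
  by (simp add: \<nu>_def[abs_def] o_def ac_simps)

lemma \<nu>_closed: "\<lbrakk>1 \<le> m; x \<in> carrier (G m)\<rbrakk> \<Longrightarrow> \<nu> m a b x \<in> carrier (G (m + a + b))"
  by (rule hom_in_carrier[OF \<nu>_hom])

lemma insert_map_eq_\<nu>: "insert_map \<iota> \<zeta> m (Suc a) (Suc (a + b)) = \<nu> m a b"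
  by (simp add: insert_map_def \<nu>_def fun_eq_iff)

lemma \<pi>_\<nu>:
  assumes "1 \<le> m" "x \<in> carrier (G m)"
  shows "\<pi> (m + a + b) (\<nu> m a b x) p = (if p \<le> a then p else a + \<pi> m x (p - a))"
  using \<pi>_\<zeta>s[of "m + b" "\<iota>s m b x" a p] \<pi>_\<iota>s[OF assms, of b] \<iota>s_closed[OF assms, of b] assms(1)
  by (simp add: \<nu>_def ac_simps)

text \<open>\<open>\<zeta>s_\<iota>s\<close> moves the later right-hand strands inside the earlier
  left-hand ones.\<close>

lemma \<nu>_\<nu>:
  assumes "1 \<le> m" "x \<in> carrier (G m)"
  shows "\<nu> (m + a + b) a' b' (\<nu> m a b x) = \<nu> m (a + a') (b + b') x"
proof -
  have "\<iota>s (m + b + a) b' (\<zeta>s (m + b) a (\<iota>s m b x)) = \<zeta>s (m + b + b') a (\<iota>s m (b + b') x)"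
    using \<zeta>s_\<iota>s[of "m + b" "\<iota>s m b x" b' a] assms by (simp add: iterate_map_add)
  then show ?thesis
    by (simp add: \<nu>_def iterate_map_add[of _ _ a a'] ac_simps)
qed

lemma \<kappa>s_\<nu>_inside:
  assumes "1 \<le> j" "j \<le> m" "x \<in> carrier (G m)"
  shows "\<kappa>s (m + a + b) (j + a) r (\<nu> m a b x) = \<nu> (m + r) a b (\<kappa>s m j r x)"
  using \<iota>s_\<kappa>s[OF assms, of r b] \<zeta>s_\<kappa>s[of j "m + b" "\<iota>s m b x" r a]
    \<iota>s_closed[OF _ assms(3), of b] assms
  by (simp add: \<nu>_def ac_simps)

lemma \<kappa>s_\<nu>_before:
  assumes "1 \<le> m" "x \<in> carrier (G m)" "c < a"
  shows "\<kappa>s (m + a + b) (Suc c) r (\<nu> m a b x) = \<nu> m (a + r) b x"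
  using \<kappa>s_\<zeta>s[of "m + b" "\<iota>s m b x" c a r] \<iota>s_closed[OF assms(1,2), of b] assms by (simp add: \<nu>_def ac_simps)

text \<open>The clone is first moved inside the \<open>a\<close> left-hand strands, which lowers its
  index by \<open>a\<close>, and is then absorbed by \<open>\<kappa>s_\<iota>s\<close>.\<close>

lemma \<kappa>s_\<nu>_after:
  assumes "1 \<le> m" "x \<in> carrier (G m)" "c < b"
  shows "\<kappa>s (m + a + b) (Suc (m + a + c)) r (\<nu> m a b x) = \<nu> m a (b + r) x"
  using \<kappa>s_\<iota>s[OF assms, of r] \<zeta>s_\<kappa>s[of "Suc (m + c)" "m + b" "\<iota>s m b x" r a]
    \<iota>s_closed[OF assms(1,2), of b] assms
  by (simp add: \<nu>_def ac_simps)

text \<open>Coordinates free of truncated subtraction: \<open>a\<close> and \<open>b\<close> count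
  the positions of \<open>f\<close> left and right of the composed one, and \<open>p\<close> the
  additional clones.\<close>

lemma cloning_circ_eq:
  assumes "n = Suc (a + b)"
  shows "cloning_circ G \<iota> \<zeta> \<kappa> n (Suc p) (Suc a) f g
         = \<kappa>s n (Suc a) p f \<otimes>\<^bsub>G (n + p)\<^esub> \<nu> (Suc p) a b g"
  by (simp add: cloning_circ_def iterate_clone_def assms insert_map_eq_\<nu>)

lemma cloning_circ_closed:
  assumes n: "n = Suc (a + b)" and f: "f \<in> carrier (G n)" and g: "g \<in> carrier (G (Suc p))"
  shows "cloning_circ G \<iota> \<zeta> \<kappa> n (Suc p) (Suc a) f g \<in> carrier (G (n + p))"
proof -
  interpret group "G (n + p)" using group_G n by simp
  show ?thesis
    unfolding cloning_circ_eq[OF n]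
    using \<kappa>s_closed[of "Suc a" n f p] \<nu>_closed[of "Suc p" g a b] assms
    by (intro m_closed) (simp_all add: ac_simps)
qed

lemma \<pi>_cloning_circ:
  assumes n: "n = Suc (a + b)" and f: "f \<in> carrier (G n)" and g: "g \<in> carrier (G (Suc p))"
  shows "\<pi> (n + p) (cloning_circ G \<iota> \<zeta> \<kappa> n (Suc p) (Suc a) f g) q
         = \<pi> (n + p) (\<kappa>s n (Suc a) p f) (if q \<le> a then q else a + \<pi> (Suc p) g (q - a))"
  unfolding cloning_circ_eq[OF n]
  using \<pi>_mult[of "n + p" "\<kappa>s n (Suc a) p f" "\<nu> (Suc p) a b g"] \<kappa>s_closed[of "Suc a" n f p]
    \<nu>_closed[of "Suc p" g a b] \<pi>_\<nu>[of "Suc p" g a b q] assms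
  by (simp add: ac_simps)

lemma \<pi>_cloning_circ_off_block:
  assumes n: "n = Suc (a + b)" and f: "f \<in> carrier (G n)" and g: "g \<in> carrier (G (Suc p))"
    and q: "1 \<le> q" "q \<le> n + p" "q \<notin> {Suc a..Suc a + p}"
  shows "\<pi> (n + p) (cloning_circ G \<iota> \<zeta> \<kappa> n (Suc p) (Suc a) f g) q
         = perm_circ n (Suc p) (Suc a) (\<pi> n f) (\<pi> (Suc p) g) q"
proof (cases "q \<le> a")
  case True
  then show ?thesis
    unfolding \<pi>_cloning_circ[OF n f g]
    using \<pi>_\<kappa>s_off_block(1)[OF f, of "Suc a" q p] q n by (simp add: perm_circ_def)
next
  case False
  \<comment> \<open>Past the block, \<open>q - a\<close> exceeds the arity of \<open>g\<close> and
    is fixed; \<open>q\<close> is then the shifted copy of position \<open>q - p\<close> of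
    \<open>f\<close>.\<close>
  then have "\<pi> (Suc p) g (q - a) = q - a"
    using q g by (intro permutes_not_in[OF \<pi>_permutes]) auto
  moreover have "q = q - p + p" "Suc a < q - p" "q - p \<le> n"
    using False q by auto
  ultimately show ?thesis
    unfolding \<pi>_cloning_circ[OF n f g]
    using \<pi>_\<kappa>s_off_block(2)[OF f, of "Suc a" "q - p" p] q n False by (simp add: perm_circ_def)
qed

end

text \<open>Now each clone keeps the value at \<open>i\<close>, and gives every later position of
  the block the value of its predecessor plus one, so the block stays in increasing order.\<close>

lemma (in restricted_bilateral_cloning_system) \<pi>_\<kappa>s_block:
  assumes x: "x \<in> carrier (G n)" and i: "1 \<le> i" "i \<le> n"
  shows "t \<le> r \<Longrightarrow> \<pi> (n + r) (\<kappa>s n i r x) (i + t) = \<pi> n x i + t"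
proof (induction r arbitrary: t)
  case (Suc r)
  let ?y = "\<kappa>s n i r x"
  have y: "?y \<in> carrier (G (n + r))" using x i by (intro \<kappa>s_closed)
  show ?case
    using \<pi>_\<kappa>[of "n + r" i ?y] y Suc.IH[of 0] Suc.IH[of "t - 1"] Suc.prems i
    by (cases t) (simp_all add: perm_clone_def)
qed simp

lemma (in restricted_bilateral_cloning_system) \<pi>_cloning_circ_eq_perm_circ:
  assumes n: "n = Suc (a + b)" and f: "f \<in> carrier (G n)" and g: "g \<in> carrier (G (Suc p))"
  shows "\<pi> (n + p) (cloning_circ G \<iota> \<zeta> \<kappa> n (Suc p) (Suc a) f g)
         = perm_circ n (Suc p) (Suc a) (\<pi> n f) (\<pi> (Suc p) g)"
proof
  fix q
  consider "q \<notin> {1..n + p}" | "q \<in> {Suc a..Suc a + p}"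
    | "1 \<le> q" "q \<le> n + p" "q \<notin> {Suc a..Suc a + p}"
    by auto
  then show "\<pi> (n + p) (cloning_circ G \<iota> \<zeta> \<kappa> n (Suc p) (Suc a) f g) q
             = perm_circ n (Suc p) (Suc a) (\<pi> n f) (\<pi> (Suc p) g) q"
  proof cases
    case 1
    have "\<pi> (n + p) (cloning_circ G \<iota> \<zeta> \<kappa> n (Suc p) (Suc a) f g) q = q"
      using 1 n cloning_circ_closed[OF n f g] by (intro permutes_not_in[OF \<pi>_permutes]) auto
    then show ?thesis using 1 by (simp add: perm_circ_def)
  next
    case 2
    have "1 \<le> \<pi> (Suc p) g (q - a) \<and> \<pi> (Suc p) g (q - a) \<le> Suc p"
      using 2 g by (intro \<pi>_in_range) auto
    moreover from this obtain t where t: "\<pi> (Suc p) g (q - a) = Suc t"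
      by (cases "\<pi> (Suc p) g (q - a)") auto
    \<comment> \<open>Positivity keeps the term \<open>\<sigma> i - 1\<close> in
      \<open>perm_circ\<close> from being truncated.\<close>
    moreover have "1 \<le> \<pi> n f (Suc a)" using \<pi>_in_range[of "Suc a" n f] f n by simp
    ultimately show ?thesis
      unfolding \<pi>_cloning_circ[OF n f g]
      using \<pi>_\<kappa>s_block[OF f, of "Suc a" t p] 2 n by (auto simp: perm_circ_def)
  next
    case 3
    then show ?thesis by (rule \<pi>_cloning_circ_off_block[OF n f g])
  qed
qed

section \<open>Compatibility with products, and the associativity laws\<close>

context operadic_cloning_system
begin

text \<open>Without the common \<open>a\<close> outer strands on the left and \<open>c\<close> on
  the right, \<open>X\<close> is an \<open>\<iota>\<close>-image and \<open>Y\<close> a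
  \<open>\<zeta>\<close>-image, which commute by \<open>\<iota>_\<zeta>_commute\<close>. The
  homomorphism \<open>\<nu>\<close> puts the outer strands back.\<close>

lemma \<nu>_commute:
  fixes a b c :: nat
  assumes "1 \<le> l" "1 \<le> m" "h \<in> carrier (G l)" "g \<in> carrier (G m)"
  defines "X \<equiv> \<nu> l a (b + m + c) h" and "Y \<equiv> \<nu> m (l + b + a) c g" and "N \<equiv> l + b + m + a + c"
  shows "X \<otimes>\<^bsub>G N\<^esub> Y = Y \<otimes>\<^bsub>G N\<^esub> X"
proof -
  let ?x = "\<iota>s (l + b) m (\<iota>s l b h)" and ?y = "\<zeta>s m (l + b) g" and ?M = "l + b + m"
  have x: "?x \<in> carrier (G ?M)" and y: "?y \<in> carrier (G ?M)"
    using assms(1-4) \<zeta>s_closed[of m g "l + b"] \<iota>s_closed[of "l + b" "\<iota>s l b h" m] \<iota>s_closed[of l h b]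
    by (simp_all add: ac_simps)
  have X: "X = \<nu> ?M a c ?x"
    using \<nu>_\<nu>[of l h 0 "b + m" a c] assms(1,3)
    by (simp add: X_def \<nu>_def iterate_map_add ac_simps)
  have Y: "Y = \<nu> ?M a c ?y"
    using \<nu>_\<nu>[of m g "l + b" 0 a c] assms(2,4) by (simp add: Y_def \<nu>_def ac_simps)
  have "?x \<otimes>\<^bsub>G ?M\<^esub> ?y = ?y \<otimes>\<^bsub>G ?M\<^esub> ?x"
    using \<iota>_\<zeta>_commute[of "l + b" m "\<iota>s l b h" g] assms(1-4) by simp
  then show ?thesis
    using hom_mult[OF \<nu>_hom x y, of a c] hom_mult[OF \<nu>_hom y x, of a c] assms(1)
    by (simp add: X Y N_def)
qed

text \<open>The left side expands to \<open>?F\<close>, \<open>?F'\<close>, \<open>?g\<close>,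
  \<open>?g'\<close> in this order. Moving \<open>?g\<close> left past \<open>?F'\<close> by
  \<open>clone_insert_commute\<close> changes its position to
  \<open>\<pi> n f' (Suc a)\<close>.\<close>

lemma cloning_circ_mult:
  assumes n: "n = Suc (a + b)"
    and f: "f \<in> carrier (G n)" "f' \<in> carrier (G n)"
    and g: "g \<in> carrier (G (Suc p))" "g' \<in> carrier (G (Suc p))"
  shows "cloning_circ G \<iota> \<zeta> \<kappa> n (Suc p) (Suc a) (f \<otimes>\<^bsub>G n\<^esub> f') (g \<otimes>\<^bsub>G (Suc p)\<^esub> g')
         = cloning_circ G \<iota> \<zeta> \<kappa> n (Suc p) (\<pi> n f' (Suc a)) f g
           \<otimes>\<^bsub>G (n + p)\<^esub> cloning_circ G \<iota> \<zeta> \<kappa> n (Suc p) (Suc a) f' g'"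
proof -
  interpret group "G (n + p)" using group_G n by simp
  have "1 \<le> \<pi> n f' (Suc a) \<and> \<pi> n f' (Suc a) \<le> n" using \<pi>_in_range[of "Suc a" n f'] n f by simp
  then obtain a' b' where j: "\<pi> n f' (Suc a) = Suc a'" and n': "n = Suc (a' + b')"
    by (metis One_nat_def Suc_le_D add_Suc le_Suc_ex)
  let ?F = "\<kappa>s n (Suc a') p f" and ?F' = "\<kappa>s n (Suc a) p f'"
    and ?g = "\<nu> (Suc p) a b g" and ?g' = "\<nu> (Suc p) a b g'" and ?h = "\<nu> (Suc p) a' b' g"
  have cl: "?F \<in> carrier (G (n + p))" "?F' \<in> carrier (G (n + p))" "?g \<in> carrier (G (n + p))"
      "?g' \<in> carrier (G (n + p))"
    using \<kappa>s_closed[of "Suc a'" n f p] \<kappa>s_closed[of "Suc a" n f' p] \<nu>_closed[of "Suc p" g a b]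
      \<nu>_closed[of "Suc p" g' a b] f g n n'
    by (simp_all add: ac_simps)
  have h: "?h \<in> carrier (G (n + p))"
    using \<nu>_closed[of "Suc p" g a' b'] g n' by (simp add: ac_simps)
  have K: "\<kappa>s n (Suc a) p (f \<otimes>\<^bsub>G n\<^esub> f') = ?F \<otimes>\<^bsub>G (n + p)\<^esub> ?F'"
    using \<kappa>s_mult[of f n f' "Suc a" p] f n j by simp
  have V: "\<nu> (Suc p) a b (g \<otimes>\<^bsub>G (Suc p)\<^esub> g') = ?g \<otimes>\<^bsub>G (n + p)\<^esub> ?g'"
    using hom_mult[OF \<nu>_hom[of "Suc p"] g, of a b] n by (simp add: ac_simps)
  have C: "?F' \<otimes>\<^bsub>G (n + p)\<^esub> ?g = ?h \<otimes>\<^bsub>G (n + p)\<^esub> ?F'"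
    using clone_insert_commute[of n "Suc p" "Suc a" f' g] f g n
      insert_map_eq_\<nu>[of "Suc p" a b] insert_map_eq_\<nu>[of "Suc p" a' b', folded n']
    by (simp add: iterate_clone_def j[symmetric])
  show ?thesis
    unfolding j cloning_circ_eq[OF n] cloning_circ_eq[OF n'] K V
    using cl h C by (metis m_assoc m_closed)
qed

text \<open>\<open>a\<close>, \<open>b\<close>, \<open>c\<close> count the positions of
  \<open>f\<close> left of, between and right of the two composed ones. The equation serves both
  disjoint cases of associativity.\<close>

lemma cloning_circ_left:
  assumes n: "n = a + b + c + 2"
    and f: "f \<in> carrier (G n)" and g: "g \<in> carrier (G (Suc p))" and h: "h \<in> carrier (G (Suc q))"
  shows "cloning_circ G \<iota> \<zeta> \<kappa> (n + p) (Suc q) (Suc a)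
           (cloning_circ G \<iota> \<zeta> \<kappa> n (Suc p) (Suc (Suc (a + b))) f g) h
         = cloning_circ G \<iota> \<zeta> \<kappa> (n + q) (Suc p) (Suc (Suc (a + b)) + q)
             (cloning_circ G \<iota> \<zeta> \<kappa> n (Suc q) (Suc a) f h) g"
proof -
  let ?i = "Suc (Suc (a + b))" and ?N = "n + p + q"
  interpret group "G ?N" using group_G n by simp
  have ni: "n = Suc (Suc (a + b) + c)" and nj: "n = Suc (a + Suc (b + c))"
    and np: "n + p = Suc (a + (b + Suc p + c))" and nq: "n + q = Suc (Suc q + b + a + c)"
    and iq: "?i + q = Suc (Suc q + b + a)"
    using n by simp_all
  let ?F = "\<kappa>s n ?i p f" and ?H = "\<kappa>s n (Suc a) q f"
    and ?g = "\<nu> (Suc p) (Suc (a + b)) c g" and ?h = "\<nu> (Suc q) a (Suc (b + c)) h"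
    and ?g' = "\<nu> (Suc p) (Suc q + b + a) c g" and ?h' = "\<nu> (Suc q) a (b + Suc p + c) h"
  have cl: "?F \<in> carrier (G (n + p))" "?H \<in> carrier (G (n + q))" "?g \<in> carrier (G (n + p))"
      "?h \<in> carrier (G (n + q))" "?g' \<in> carrier (G ?N)" "?h' \<in> carrier (G ?N)"
    using \<kappa>s_closed[of ?i n f p] \<kappa>s_closed[of "Suc a" n f q]
      \<nu>_closed[of "Suc p" g "Suc (a + b)" c] \<nu>_closed[of "Suc q" h a "Suc (b + c)"]
      \<nu>_closed[of "Suc p" g "Suc q + b + a" c] \<nu>_closed[of "Suc q" h a "b + Suc p + c"] f g h n
    by (simp_all add: ac_simps)
  let ?K = "\<kappa>s (n + p) (Suc a) q ?F"
  have K: "?K \<in> carrier (G ?N)" using \<kappa>s_closed[of "Suc a" "n + p" ?F q] cl n by simp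
  have KK: "\<kappa>s (n + q) (?i + q) p ?H = ?K"
    using \<kappa>s_\<kappa>s[of "Suc a" ?i n f p q] f n by simp
  have kg: "\<kappa>s (n + p) (Suc a) q ?g = ?g'"
    using \<kappa>s_\<nu>_before[of "Suc p" g a "Suc (a + b)" c q] g n by (simp add: ac_simps)
  have kh: "\<kappa>s (n + q) (?i + q) p ?h = ?h'"
    using \<kappa>s_\<nu>_after[of "Suc q" h b "Suc (b + c)" a p] h n by (simp add: ac_simps)
  \<comment> \<open>Each of the two positions lies on an added strand, which the inserted element
    fixes, so \<open>\<kappa>s_mult\<close> does not change the cloning index.\<close>
  have pg: "\<pi> (n + p) ?g (Suc a) = Suc a"
    using \<pi>_\<nu>[of "Suc p" g "Suc (a + b)" c "Suc a"] g n by (simp add: ac_simps)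
  have ph: "\<pi> (n + q) ?h (?i + q) = ?i + q"
  proof -
    have "\<pi> (Suc q) h (Suc (Suc (b + q))) = Suc (Suc (b + q))"
      using h by (intro permutes_not_in[OF \<pi>_permutes]) auto
    then show ?thesis
      using \<pi>_\<nu>[of "Suc q" h a "Suc (b + c)" "?i + q"] h n by (simp add: ac_simps)
  qed
  have "cloning_circ G \<iota> \<zeta> \<kappa> (n + p) (Suc q) (Suc a) (cloning_circ G \<iota> \<zeta> \<kappa> n (Suc p) ?i f g) h
        = ?K \<otimes>\<^bsub>G ?N\<^esub> ?g' \<otimes>\<^bsub>G ?N\<^esub> ?h'"
    unfolding cloning_circ_eq[OF ni] cloning_circ_eq[OF np]
    using \<kappa>s_mult[of ?F "n + p" ?g "Suc a" q] cl n kg pg by simp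
  also have "\<dots> = ?K \<otimes>\<^bsub>G ?N\<^esub> ?h' \<otimes>\<^bsub>G ?N\<^esub> ?g'"
  proof -
    have "?h' \<otimes>\<^bsub>G ?N\<^esub> ?g' = ?g' \<otimes>\<^bsub>G ?N\<^esub> ?h'"
      using \<nu>_commute[where l = "Suc q" and m = "Suc p" and a = a and b = b and c = c, OF _ _ h g] n
      by (simp add: ac_simps)
    then show ?thesis using K cl by (simp add: m_assoc)
  qed
  also have "\<dots> = cloning_circ G \<iota> \<zeta> \<kappa> (n + q) (Suc p) (?i + q)
                    (cloning_circ G \<iota> \<zeta> \<kappa> n (Suc q) (Suc a) f h) g"
    unfolding cloning_circ_eq[OF nj] iq cloning_circ_eq[OF nq]
    using \<kappa>s_mult[of ?H "n + q" ?h "?i + q" p] cl n KK kh ph by (simp add: ac_simps)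
  finally show ?thesis .
qed

lemma cloning_circ_nested:
  assumes n: "n = Suc (a + b)" and p: "p = c + d"
    and f: "f \<in> carrier (G n)" and g: "g \<in> carrier (G (Suc p))" and h: "h \<in> carrier (G (Suc q))"
  shows "cloning_circ G \<iota> \<zeta> \<kappa> (n + p) (Suc q) (Suc c + a)
           (cloning_circ G \<iota> \<zeta> \<kappa> n (Suc p) (Suc a) f g) h
         = cloning_circ G \<iota> \<zeta> \<kappa> n (Suc (p + q)) (Suc a) f
             (cloning_circ G \<iota> \<zeta> \<kappa> (Suc p) (Suc q) (Suc c) g h)"
proof -
  let ?N = "n + p + q"
  interpret group "G ?N" using group_G n by simp
  have pc: "Suc p = Suc (c + d)" and np: "n + p = Suc ((c + a) + (d + b))"
    using n p by simp_all
  let ?F = "\<kappa>s n (Suc a) p f" and ?g = "\<nu> (Suc p) a b g" and ?k = "\<kappa>s (Suc p) (Suc c) q g"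
    and ?h = "\<nu> (Suc q) c d h" and ?K = "\<kappa>s n (Suc a) (p + q) f" and ?j = "\<pi> (Suc p) g (Suc c)"
  have cl: "?F \<in> carrier (G (n + p))" "?g \<in> carrier (G (n + p))" "?K \<in> carrier (G ?N)"
      "?k \<in> carrier (G (Suc (p + q)))" "?h \<in> carrier (G (Suc (p + q)))"
    using \<kappa>s_closed[of "Suc a" n f p] \<kappa>s_closed[of "Suc a" n f "p + q"]
      \<kappa>s_closed[of "Suc c" "Suc p" g q] \<nu>_closed[of "Suc p" g a b] \<nu>_closed[of "Suc q" h c d] f g h n p
    by (simp_all add: ac_simps)
  have vcl: "\<nu> (Suc (p + q)) a b ?k \<in> carrier (G ?N)" "\<nu> (Suc (p + q)) a b ?h \<in> carrier (G ?N)"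
    using \<nu>_closed[of "Suc (p + q)" ?k a b] \<nu>_closed[of "Suc (p + q)" ?h a b] cl n
    by (simp_all add: ac_simps)
  have kg: "\<kappa>s (n + p) (Suc c + a) q ?g = \<nu> (Suc (p + q)) a b ?k"
    using \<kappa>s_\<nu>_inside[of "Suc c" "Suc p" g a b q] g n p by (simp add: ac_simps)
  \<comment> \<open>The insertion of \<open>h\<close> factors through arity
    \<open>Suc (p + q)\<close>, where it can be multiplied with the cloned \<open>g\<close>.\<close>
  have vh: "\<nu> (Suc q) (c + a) (d + b) h = \<nu> (Suc (p + q)) a b ?h"
    using \<nu>_\<nu>[of "Suc q" h c d a b] h p by (simp add: ac_simps)
  have j: "1 \<le> ?j \<and> ?j \<le> Suc p" using \<pi>_in_range[of "Suc c" "Suc p" g] g p by simp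
  \<comment> \<open>The new index depends on \<open>g\<close>, but it stays in the block of clones
    of \<open>f\<close>; \<open>\<kappa>s_block\<close> removes the dependence.\<close>
  have pg: "\<pi> (n + p) ?g (Suc c + a) = Suc a + (?j - 1)"
    using \<pi>_\<nu>[of "Suc p" g a b "Suc c + a"] g n j by (simp add: ac_simps)
  have KK: "\<kappa>s (n + p) (Suc a + (?j - 1)) q ?F = ?K"
    using j n f by (intro \<kappa>s_block) auto
  have "cloning_circ G \<iota> \<zeta> \<kappa> (n + p) (Suc q) (Suc c + a) (cloning_circ G \<iota> \<zeta> \<kappa> n (Suc p) (Suc a) f g) h
        = ?K \<otimes>\<^bsub>G ?N\<^esub> \<nu> (Suc (p + q)) a b ?k \<otimes>\<^bsub>G ?N\<^esub> \<nu> (Suc (p + q)) a b ?h"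
    unfolding cloning_circ_eq[OF n] add_Suc cloning_circ_eq[OF np]
    using \<kappa>s_mult[of ?F "n + p" ?g "Suc c + a" q] cl n p kg pg KK vh by simp
  also have "\<dots> = ?K \<otimes>\<^bsub>G ?N\<^esub> \<nu> (Suc (p + q)) a b (?k \<otimes>\<^bsub>G (Suc (p + q))\<^esub> ?h)"
  proof -
    have "\<nu> (Suc (p + q)) a b (?k \<otimes>\<^bsub>G (Suc (p + q))\<^esub> ?h)
          = \<nu> (Suc (p + q)) a b ?k \<otimes>\<^bsub>G ?N\<^esub> \<nu> (Suc (p + q)) a b ?h"
      using hom_mult[OF \<nu>_hom cl(4,5), of a b] n by (simp add: ac_simps)
    then show ?thesis using vcl cl by (simp add: m_assoc)
  qed
  also have "\<dots> = cloning_circ G \<iota> \<zeta> \<kappa> n (Suc (p + q)) (Suc a) f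
                    (cloning_circ G \<iota> \<zeta> \<kappa> (Suc p) (Suc q) (Suc c) g h)"
    unfolding cloning_circ_eq[OF n] cloning_circ_eq[OF pc] by (simp add: ac_simps)
  finally show ?thesis .
qed

section \<open>Verification of the operad axioms in the original coordinates\<close>

lemma action_operad_base: "action_operad_base G \<pi> (cloning_circ G \<iota> \<zeta> \<kappa>) \<one>\<^bsub>G 1\<^esub>"
proof (intro action_operad_base.intro nonsymmetric_operad.intro action_operad_base_axioms.intro)
  show "\<one>\<^bsub>G 1\<^esub> \<in> carrier (G 1)" using group_G[of 1] by (simp add: group.is_monoid monoid.one_closed)
next
  fix n m i :: nat and f g
  assume *: "1 \<le> n" "1 \<le> m" "1 \<le> i" "i \<le> n" and **: "f \<in> carrier (G n)" "g \<in> carrier (G m)"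
  obtain a b p where "i = Suc a" "n = Suc (a + b)" "m = Suc p"
    using * by (metis One_nat_def Suc_le_D add_Suc le_Suc_ex)
  then show "cloning_circ G \<iota> \<zeta> \<kappa> n m i f g \<in> carrier (G (n + m - 1))"
    using ** cloning_circ_closed[of n a b f g p] by simp
next
  fix n m l i j :: nat and f g h
  assume *: "1 \<le> n" "1 \<le> m" "1 \<le> l" "1 \<le> i" "i \<le> n" "1 \<le> j" "j < i"
    and **: "f \<in> carrier (G n)" "g \<in> carrier (G m)" "h \<in> carrier (G l)"
  show "cloning_circ G \<iota> \<zeta> \<kappa> (n + m - 1) l j (cloning_circ G \<iota> \<zeta> \<kappa> n m i f g) h
        = cloning_circ G \<iota> \<zeta> \<kappa> (n + l - 1) m (i + l - 1) (cloning_circ G \<iota> \<zeta> \<kappa> n l j f h) g"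
  proof -
    obtain a b c p q where "j = Suc a" "i = Suc (Suc (a + b))" "n = a + b + c + 2" "m = Suc p" "l = Suc q"
      using * by (auto simp: Suc_le_eq gr0_conv_Suc less_iff_Suc_add le_iff_add)
    then show ?thesis using cloning_circ_left[of n a b c f g p h q] ** by simp
  qed
next
  fix n m l i j :: nat and f g h
  assume *: "1 \<le> n" "1 \<le> m" "1 \<le> l" "1 \<le> i" "i \<le> n" "i + m \<le> j" "j \<le> n + m - 1"
    and **: "f \<in> carrier (G n)" "g \<in> carrier (G m)" "h \<in> carrier (G l)"
  show "cloning_circ G \<iota> \<zeta> \<kappa> (n + m - 1) l j (cloning_circ G \<iota> \<zeta> \<kappa> n m i f g) h
        = cloning_circ G \<iota> \<zeta> \<kappa> (n + l - 1) m i (cloning_circ G \<iota> \<zeta> \<kappa> n l (j + 1 - m) f h) g"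
  proof -
    obtain a b c p q where "i = Suc a" "m = Suc p" "l = Suc q" "j = Suc (Suc (a + b)) + p" "n = a + b + c + 2"
      using * by (auto simp: Suc_le_eq gr0_conv_Suc less_iff_Suc_add le_iff_add)
    \<comment> \<open>The same equation read from right to left, with \<open>g\<close> and
      \<open>h\<close> exchanged.\<close>
    then show ?thesis using cloning_circ_left[of n a b c f h q g p] ** by simp
  qed
next
  fix n m l i j :: nat and f g h
  assume *: "1 \<le> n" "1 \<le> m" "1 \<le> l" "1 \<le> i" "i \<le> n" "i \<le> j" "j \<le> i + m - 1"
    and **: "f \<in> carrier (G n)" "g \<in> carrier (G m)" "h \<in> carrier (G l)"
  show "cloning_circ G \<iota> \<zeta> \<kappa> (n + m - 1) l j (cloning_circ G \<iota> \<zeta> \<kappa> n m i f g) h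
        = cloning_circ G \<iota> \<zeta> \<kappa> n (m + l - 1) i f (cloning_circ G \<iota> \<zeta> \<kappa> m l (j - i + 1) g h)"
  proof -
    obtain a b c d q where "i = Suc a" "n = Suc (a + b)" "j = Suc c + a" "m = Suc (c + d)" "l = Suc q"
    proof -
      have "i = Suc (i - 1)" "n = Suc (i - 1 + (n - i))" "j = Suc (j - i) + (i - 1)"
          "m = Suc (j - i + (i + m - 1 - j))" "l = Suc (l - 1)"
        using * by auto
      then show ?thesis by (rule that)
    qed
    then show ?thesis using cloning_circ_nested[of n a b "c + d" c d f g h q] ** by simp
  qed
next
  fix n i :: nat and f
  assume *: "1 \<le> n" "1 \<le> i" "i \<le> n" "f \<in> carrier (G n)"
  interpret G1: group "G 1" using group_G[of 1] by simp
  interpret Gn: group "G n" using group_G * by simp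
  obtain a b where i: "i = Suc a" and n: "n = Suc (a + b)"
    using * by (metis One_nat_def Suc_le_D add_Suc le_Suc_ex)
  have "\<nu> 1 a b \<one>\<^bsub>G 1\<^esub> = \<one>\<^bsub>G n\<^esub>"
    using hom_one[OF \<nu>_hom[of 1 a b] G1.is_group] Gn.is_group n by simp
  then show "cloning_circ G \<iota> \<zeta> \<kappa> n 1 i f \<one>\<^bsub>G 1\<^esub> = f"
    using cloning_circ_eq[OF n, of 0] * i by simp
next
  fix m :: nat and g
  assume *: "1 \<le> m" "g \<in> carrier (G m)"
  interpret Gm: group "G m" using group_G * by simp
  obtain p where m: "m = Suc p" using * by (metis One_nat_def Suc_le_D)
  show "cloning_circ G \<iota> \<zeta> \<kappa> 1 m 1 \<one>\<^bsub>G 1\<^esub> g = g"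
    using cloning_circ_eq[of 1 0 0 p] \<kappa>s_one[of 1 1 p] Gm.l_one * m by (simp add: \<nu>_def)
next
  fix n :: nat
  assume n: "1 \<le> n"
  show "group (G n)" using n by (rule group_G)
  show "\<pi> n \<in> hom (G n) (sym_group n)" using n by (rule \<pi>_hom)
next
  fix n m i :: nat and f f' g g'
  assume *: "1 \<le> n" "1 \<le> m" "1 \<le> i" "i \<le> n"
    and **: "f \<in> carrier (G n)" "f' \<in> carrier (G n)" "g \<in> carrier (G m)" "g' \<in> carrier (G m)"
  show "cloning_circ G \<iota> \<zeta> \<kappa> n m i (f \<otimes>\<^bsub>G n\<^esub> f') (g \<otimes>\<^bsub>G m\<^esub> g')
        = cloning_circ G \<iota> \<zeta> \<kappa> n m (\<pi> n f' i) f g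
          \<otimes>\<^bsub>G (n + m - 1)\<^esub> cloning_circ G \<iota> \<zeta> \<kappa> n m i f' g'"
    using cloning_circ_mult[of n "i - 1" "n - i" f f' g "m - 1" g'] * ** by simp
qed

lemma general_action_operad: "general_action_operad G \<pi> (cloning_circ G \<iota> \<zeta> \<kappa>) \<one>\<^bsub>G 1\<^esub>"
proof (intro general_action_operad.intro general_action_operad_axioms.intro)
  show "action_operad_base G \<pi> (cloning_circ G \<iota> \<zeta> \<kappa>) \<one>\<^bsub>G 1\<^esub>" by (rule action_operad_base)
next
  fix n m i q :: nat and g h
  assume *: "1 \<le> n" "1 \<le> m" "1 \<le> i" "i \<le> n" "g \<in> carrier (G n)" "h \<in> carrier (G m)"
    and q: "q \<in> {1..n + m - 1} - {i..i + m - 1}"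
  show "perm_circ n m i (\<pi> n g) (\<pi> m h) q = \<pi> (n + m - 1) (cloning_circ G \<iota> \<zeta> \<kappa> n m i g h) q"
    using \<pi>_cloning_circ_off_block[of n "i - 1" "n - i" g h "m - 1" q] * q by auto
qed

end

lemma restricted_action_operad:
  assumes "restricted_bilateral_cloning_system G \<iota> \<zeta> \<kappa> \<pi>" and "operadic_cloning_system G \<iota> \<zeta> \<kappa> \<pi>"
  shows "action_operad G \<pi> (cloning_circ G \<iota> \<zeta> \<kappa>) \<one>\<^bsub>G 1\<^esub>"
proof -
  interpret restricted_bilateral_cloning_system G \<iota> \<zeta> \<kappa> \<pi> by (rule assms(1))
  interpret operadic_cloning_system G \<iota> \<zeta> \<kappa> \<pi> by (rule assms(2))
  show ?thesis
  proof (intro action_operad.intro action_operad_axioms.intro)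
    show "action_operad_base G \<pi> (cloning_circ G \<iota> \<zeta> \<kappa>) \<one>\<^bsub>G 1\<^esub>" by (rule action_operad_base)
    show "\<pi> 1 \<one>\<^bsub>G 1\<^esub> = id" by (rule \<pi>_one) simp
  next
    fix n m i :: nat and g h
    assume "1 \<le> n" "1 \<le> m" "1 \<le> i" "i \<le> n" "g \<in> carrier (G n)" "h \<in> carrier (G m)"
    then show "\<pi> (n + m - 1) (cloning_circ G \<iota> \<zeta> \<kappa> n m i g h) = perm_circ n m i (\<pi> n g) (\<pi> m h)"
      using \<pi>_cloning_circ_eq_perm_circ[of n "i - 1" "n - i" g h "m - 1"] by simp
  qed
qed

theorem proposition6p2:
  fixes G :: "nat \<Rightarrow> ('a, 'b) monoid_scheme"
    and \<iota> \<zeta> :: "nat \<Rightarrow> 'a \<Rightarrow> 'a"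
    and \<kappa> :: "nat \<Rightarrow> nat \<Rightarrow> 'a \<Rightarrow> 'a"
    and \<pi> :: "nat \<Rightarrow> 'a \<Rightarrow> nat \<Rightarrow> nat"
  shows "(restricted_bilateral_cloning_system G \<iota> \<zeta> \<kappa> \<pi> \<and> operadic_cloning_system G \<iota> \<zeta> \<kappa> \<pi>
            \<longrightarrow> action_operad G \<pi> (cloning_circ G \<iota> \<zeta> \<kappa>) \<one>\<^bsub>G 1\<^esub>)
       \<and> (operadic_cloning_system G \<iota> \<zeta> \<kappa> \<pi>
            \<longrightarrow> general_action_operad G \<pi> (cloning_circ G \<iota> \<zeta> \<kappa>) \<one>\<^bsub>G 1\<^esub>)"
  using restricted_action_operad operadic_cloning_system.general_action_operad by blast

end
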